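(* For $s>1$ there is no constant $C_1>0$ with the following property: for every open, horizontally bounded and (Euclidean) convex set $\Omega\subset\mathbb H^1$ and every continuous $H$-convex function $u:\overline\Omega\to\mathbb R$ with $u=0$ on $\partial\Omega$, $$|u(\xi)|^2\le C_1\,\mathrm{dist}_H(\xi,\partial\Omega)^s\,\mathrm{diam}_{HS}(\Omega)\,\mathcal L^2_{HS}(\partial_Hu(\Omega))\qquad\forall\xi\in\Omega.$$ More precisely, for every $\varepsilon\in(0,1)$ there exist an open, bounded, convex set $\Omega\subset\mathbb H^1$ and a continuous $H$-convex function $u:\overline\Omega\to\mathbb R$ with $u=0$ on $\partial\Omega$, $u<0$ in $\Omega$, $\mathcal L^2_{HS}(\partial_Hu(\Omega))<\infty$, and $$\sup_{\xi\in\Omega}\frac{|u(\xi)|^2}{\mathrm{dist}_H(\xi,\partial\Omega)^{1+\varepsilon}}=+\infty.$$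
   Context: $\mathbb H^1=\mathbb C\times\mathbb R\cong\mathbb R^3$ with coordinates $(x,y,t)$, group law $(x,y,t)\circ(x',y',t')=(x+x',y+y',t+t'+2(x'y-xy'))$. Dilations $\delta_\lambda(x,y,t)=(\lambda x,\lambda y,\lambda^2t)$. Horizontal plane at $\xi_0=(x_0,y_0,t_0)$: $H_{\xi_0}=\{(x,y,t):t=t_0+2(xy_0-x_0y)\}$. $\mathrm{Pr}_1(x,y,t)=(x,y)$. Gauge $N(x,y,t)=((x^2+y^2)^2+t^2)^{1/4}$, $d_H(\xi,\zeta)=N(\zeta^{-1}\circ\xi)$, $\mathrm{dist}_H(\xi,A)=\inf_{\zeta\in A}d_H(\xi,\zeta)$, $\mathrm{diam}_H$ the $d_H$-diameter; $\mathrm{diam}_{HS}(\Omega)=\sup\{\mathrm{diam}_H(\Omega\cap H_\xi):\xi\in\Omega\}$, and $\Omega$ is horizontally bounded if it is finite. A function $u$ on an $H$-convex set $\tilde\Omega$ is $H$-convex if $u(\xi_1\circ\delta_\lambda(\xi_1^{-1}\circ\xi_2))\le(1-\lambda)u(\xi_1)+\lambda u(\xi_2)$ for all $\xi_1,\xi_2\in\tilde\Omega$ with $\xi_1\in H_{\xi_2}$, $\lambda\in[0,1]$. $\partial_Hu(\xi)=\{p\in\mathbb R^2:u(\zeta)\ge u(\xi)+p\cdot(\mathrm{Pr}_1(\zeta)-\mathrm{Pr}_1(\xi))\ \forall\zeta\in\Omega\cap H_\xi\}$, $\partial_Hu(E)=\bigcup_{\xi\in E}\partial_Hu(\xi)$,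 $\mathcal L^2_{HS}(\partial_Hu(\Omega))=\sup_{\xi\in\Omega}\mathcal L^2(\partial_Hu(\Omega\cap H_\xi))$. *)

theory Defs
  imports "HOL-Analysis.Analysis"
begin

type_synonym heis = "real \<times> real \<times> real"

definition hmult :: "heis \<Rightarrow> heis \<Rightarrow> heis" (infixl "\<circ>\<^sub>H" 70) where
  "hmult p q = (case p of (x,y,t) \<Rightarrow> case q of (x',y',t') \<Rightarrow>
      (x + x', y + y', t + t' + 2 * (x' * y - x * y')))"

definition hinv :: "heis \<Rightarrow> heis" where
  "hinv p = (case p of (x,y,t) \<Rightarrow> (-x, -y, -t))"

definition hdil :: "real \<Rightarrow> heis \<Rightarrow> heis" where
  "hdil l p = (case p of (x,y,t) \<Rightarrow> (l * x, l * y, l^2 * t))"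

definition hplane :: "heis \<Rightarrow> heis set" where
  "hplane p0 = (case p0 of (x0,y0,t0) \<Rightarrow> {(x,y,t). t = t0 + 2 * (x * y0 - x0 * y)})"

definition Pr1 :: "heis \<Rightarrow> real \<times> real" where
  "Pr1 p = (case p of (x,y,t) \<Rightarrow> (x,y))"

definition gauge :: "heis \<Rightarrow> real" where
  "gauge p = (case p of (x,y,t) \<Rightarrow> root 4 ((x^2 + y^2)^2 + t^2))"

definition dH :: "heis \<Rightarrow> heis \<Rightarrow> real" where
  "dH \<xi> \<zeta> = gauge (hinv \<zeta> \<circ>\<^sub>H \<xi>)"

definition distH :: "heis \<Rightarrow> heis set \<Rightarrow> real" where
  "distH \<xi> A = (INF \<zeta>\<in>A. dH \<xi> \<zeta>)"

definition diamH :: "heis set \<Rightarrow> ereal" where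
  "diamH S = (SUP p\<in>S \<times> S. ereal (dH (fst p) (snd p)))"

definition diamHS :: "heis set \<Rightarrow> ereal" where
  "diamHS \<Omega> = (SUP \<xi>\<in>\<Omega>. diamH (\<Omega> \<inter> hplane \<xi>))"

definition horiz_bounded :: "heis set \<Rightarrow> bool" where
  "horiz_bounded \<Omega> \<longleftrightarrow> diamHS \<Omega> < \<infinity>"

definition H_convex_on :: "heis set \<Rightarrow> (heis \<Rightarrow> real) \<Rightarrow> bool" where
  "H_convex_on S u \<longleftrightarrow> (\<forall>\<xi>1\<in>S. \<forall>\<xi>2\<in>S. \<forall>l\<in>{0..1}. \<xi>1 \<in> hplane \<xi>2 \<longrightarrow>
      u (\<xi>1 \<circ>\<^sub>H hdil l (hinv \<xi>1 \<circ>\<^sub>H \<xi>2)) \<le> (1 - l) * u \<xi>1 + l * u \<xi>2)"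

definition subdiffH :: "heis set \<Rightarrow> (heis \<Rightarrow> real) \<Rightarrow> heis \<Rightarrow> (real \<times> real) set" where
  "subdiffH \<Omega> u \<xi> = {p. \<forall>\<zeta>\<in>\<Omega> \<inter> hplane \<xi>. u \<zeta> \<ge> u \<xi> + inner p (Pr1 \<zeta> - Pr1 \<xi>)}"

definition subdiffH_set :: "heis set \<Rightarrow> (heis \<Rightarrow> real) \<Rightarrow> heis set \<Rightarrow> (real \<times> real) set" where
  "subdiffH_set \<Omega> u E = (\<Union>\<xi>\<in>E. subdiffH \<Omega> u \<xi>)"

definition L2 :: "(real \<times> real) set \<Rightarrow> ennreal" where
  "L2 A = (INF T\<in>{T. T \<in> sets lebesgue \<and> A \<subseteq> T}. emeasure lebesgue T)"

definition L2_HS :: "heis set \<Rightarrow> (heis \<Rightarrow> real) \<Rightarrow> ennreal" where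
  "L2_HS \<Omega> u = (SUP \<xi>\<in>\<Omega>. L2 (subdiffH_set \<Omega> u (\<Omega> \<inter> hplane \<xi>)))"

end

theory Submission
  imports Defs
begin

text \<open>Over the convex wedge \<open>0 < x < z\<close> with the concave roof \<open>z = 1 - \<bar>y\<bar> - \<bar>t\<bar>\<close> take
  \<open>u = x - x powr a * z powr (1 - a)\<close>, where \<open>1/2 < a < 1\<close>. It is convex in the Euclidean sense,
  hence \<open>H\<close>-convex, and vanishes on both faces. With \<open>\<rho> = x / z\<close>, the horizontal subgradients
  satisfy \<open>\<bar>p\<^sub>1\<bar> \<lesssim> \<rho> powr (a - 1)\<close> and \<open>\<bar>p\<^sub>2\<bar> \<lesssim> \<rho> powr a\<close>. As \<open>a > 1/2\<close>, these bounds confine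
  the subgradients at all points of the wedge to one set of finite area. Along the \<open>x\<close>-axis
  \<open>\<bar>u\<bar>\<^sup>2\<close> is of order \<open>x powr (2 * a)\<close> whereas the distance to the boundary is \<open>x\<close>, and \<open>2 * a\<close>
  can be chosen as close to \<open>1\<close> as desired.\<close>

section \<open>Convexity and boundary of the wedge\<close>

definition roof :: "real \<Rightarrow> real \<Rightarrow> real" where
  "roof y t = 1 - \<bar>y\<bar> - \<bar>t\<bar>"

definition wedge :: "heis set" where
  "wedge = {(x,y,t). 0 < x \<and> x < roof y t}"

text \<open>The subtracted term is the weighted geometric mean of \<open>x\<close> and
  \<open>roof y t\<close>: jointly concave, homogeneous of degree one, and equal to \<open>x\<close>
  on both faces. On the face \<open>x = 0\<close> this relies on
  \<open>0 powr a = 0\<close>.\<close>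

definition sag :: "real \<Rightarrow> heis \<Rightarrow> real" where
  "sag a = (\<lambda>(x,y,t). x - x powr a * roof y t powr (1 - a))"

lemma mem_wedge: "(x,y,t) \<in> wedge \<longleftrightarrow> 0 < x \<and> x < roof y t"
  by (simp add: wedge_def)

lemma roof_concave:
  assumes "0 \<le> l" "l \<le> (1::real)"
  shows "(1 - l) * roof y1 t1 + l * roof y2 t2
           \<le> roof ((1 - l) * y1 + l * y2) ((1 - l) * t1 + l * t2)"
proof -
  have *: "\<bar>(1 - l) * b + l * c\<bar> \<le> (1 - l) * \<bar>b\<bar> + l * \<bar>c\<bar>" for b c :: real
    using abs_triangle_ineq[of "(1 - l) * b" "l * c"] assms by (simp add: abs_mult)
  show ?thesis
    using *[of y1 y2] *[of t1 t2] by (simp add: roof_def algebra_simps)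
qed

lemma roof_lipschitz: "\<bar>roof y' t' - roof y t\<bar> \<le> \<bar>y' - y\<bar> + \<bar>t' - t\<bar>"
  unfolding roof_def by linarith

lemma open_wedge: "open wedge"
proof -
  have "wedge = {p. 0 < fst p} \<inter> {p. fst p < roof (fst (snd p)) (snd (snd p))}"
    by (auto simp: wedge_def)
  also have "open \<dots>"
    unfolding roof_def
    by (intro open_Int open_Collect_less continuous_intros)
  finally show ?thesis .
qed

lemma convex_wedge: "convex wedge"
proof (rule convexI)
  fix p q :: heis and v l :: real
  assume pq: "p \<in> wedge" "q \<in> wedge" and vl: "0 \<le> v" "0 \<le> l" "v + l = 1"
  obtain x1 y1 t1 x2 y2 t2 where p: "p = (x1,y1,t1)" and q: "q = (x2,y2,t2)"
    by (metis prod_cases3)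
  have v: "v = 1 - l" using vl by simp
  have x: "0 < x1" "x1 < roof y1 t1" "0 < x2" "x2 < roof y2 t2"
    using pq by (auto simp: p q mem_wedge)
  have "0 < v * x1 + l * x2"
    using x vl by (metis add_pos_nonneg add_nonneg_pos less_eq_real_def mult_nonneg_nonneg mult_pos_pos zero_less_one add.right_neutral)
  moreover have "v * x1 + l * x2 < v * roof y1 t1 + l * roof y2 t2"
    using x vl by (smt (verit) mult_left_mono mult_strict_left_mono)
  moreover have "v * roof y1 t1 + l * roof y2 t2 \<le> roof (v * y1 + l * y2) (v * t1 + l * t2)"
    using roof_concave[of l] vl unfolding v by simp
  ultimately show "v *\<^sub>R p + l *\<^sub>R q \<in> wedge"
    by (simp add: p q mem_wedge)
qed

lemma wedge_subset_cube: "(x,y,t) \<in> wedge \<Longrightarrow> 0 < x \<and> x < 1 \<and> \<bar>y\<bar> < 1 \<and> \<bar>t\<bar> < 1"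
  by (auto simp: mem_wedge roof_def)

lemma bounded_wedge: "bounded wedge"
proof (rule bounded_subset)
  show "bounded (cbox (-1, -1, -1) (1, 1, 1) :: heis set)" by (rule bounded_cbox)
  show "wedge \<subseteq> cbox (-1, -1, -1) (1, 1, 1)"
    using wedge_subset_cube by (force simp: cbox_Pair_eq)
qed

lemma closure_wedge_subset: "closure wedge \<subseteq> {(x,y,t). 0 \<le> x \<and> x \<le> roof y t}"
proof (rule closure_minimal)
  have "{(x,y,t). 0 \<le> x \<and> x \<le> roof y t} =
      {p. 0 \<le> fst p} \<inter> {p. fst p \<le> roof (fst (snd p)) (snd (snd p))}"
    by auto
  also have "closed \<dots>"
    unfolding roof_def
    by (intro closed_Int closed_Collect_le continuous_intros)
  finally show "closed {(x,y,t). 0 \<le> x \<and> x \<le> roof y t}" .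
qed (auto simp: wedge_def)

lemma frontier_wedge_cases:
  assumes "(x,y,t) \<in> frontier wedge"
  shows "0 \<le> x \<and> x \<le> roof y t \<and> (x = 0 \<or> x = roof y t)"
proof -
  have "(x,y,t) \<in> closure wedge" "(x,y,t) \<notin> wedge"
    using assms by (auto simp: frontier_def interior_open[OF open_wedge])
  then show ?thesis using closure_wedge_subset by (auto simp: mem_wedge)
qed

lemma origin_in_frontier: "(0,0,0) \<in> frontier wedge"
proof -
  have "(0,0,0) \<in> closure wedge"
    unfolding closure_approachable
  proof (intro allI impI)
    fix e :: real assume "0 < e"
    then have "(min (e/2) (1/2), 0, 0) \<in> wedge" "dist (min (e/2) (1/2), 0::real, 0::real) (0,0,0) < e"
      by (auto simp: mem_wedge roof_def dist_Pair_Pair min_def)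
    then show "\<exists>p\<in>wedge. dist p (0,0,0) < e" by blast
  qed
  then show ?thesis
    by (simp add: frontier_def interior_open[OF open_wedge] mem_wedge)
qed

section \<open>Heisenberg distances in the wedge\<close>

lemma dH_eq:
  "dH (x,y,t) (x',y',t') =
     root 4 (((x - x')^2 + (y - y')^2)^2 + (t - t' + 2 * (x' * y - x * y'))^2)"
  by (simp add: dH_def gauge_def hinv_def hmult_def algebra_simps)

lemma dH_nonneg: "0 \<le> dH p q"
  by (cases p, cases q) (simp add: dH_eq)

lemma dH_pow4:
  "dH (x,y,t) (x',y',t') ^ 4 =
     ((x - x')^2 + (y - y')^2)^2 + (t - t' + 2 * (x' * y - x * y'))^2"
  by (simp add: dH_eq)

text \<open>The fourth power of the distance is a sum of two squares. Keeping the first and taking a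
  square root gives this bound; \<open>dH_ge_vertical\<close> keeps the second.\<close>

lemma dH_ge_Pr1: "(x - x')^2 + (y - y')^2 \<le> dH (x,y,t) (x',y',t') ^ 2"
proof (rule power2_le_imp_le)
  have "((x - x')^2 + (y - y')^2)^2 \<le> dH (x,y,t) (x',y',t') ^ 4"
    by (simp add: dH_pow4)
  then show "((x - x')^2 + (y - y')^2)^2 \<le> (dH (x,y,t) (x',y',t') ^ 2)^2"
    by simp
qed simp

lemma dH_ge_vertical: "\<bar>t - t' + 2 * (x' * y - x * y')\<bar> \<le> dH (x,y,t) (x',y',t') ^ 2"
proof (rule power2_le_imp_le)
  have "(t - t' + 2 * (x' * y - x * y'))^2 \<le> dH (x,y,t) (x',y',t') ^ 4"
    by (simp add: dH_pow4)
  then show "\<bar>t - t' + 2 * (x' * y - x * y')\<bar>^2 \<le> (dH (x,y,t) (x',y',t') ^ 2)^2"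
    by simp
qed simp

text \<open>The origin realises the distance \<open>x\<close>. A boundary point closer than
  \<open>x\<close> has \<open>x' \<noteq> 0\<close>, so it lies on the roof face, where
  \<open>x' + \<bar>y'\<bar> + \<bar>t'\<bar> = 1\<close>; but near the origin these three
  coordinates are too small for that.\<close>

lemma distH_axis:
  assumes x: "0 < x" "x \<le> 1/20"
  shows "distH (x,0,0) (frontier wedge) = x"
proof (rule antisym)
  have "dH (x,0,0) (0,0,0) = x"
    using x by (simp add: dH_eq real_root_power_cancel)
  then show "distH (x,0,0) (frontier wedge) \<le> x"
    unfolding distH_def
    by (metis cINF_lower bdd_belowI2 dH_nonneg origin_in_frontier)
  show "x \<le> distH (x,0,0) (frontier wedge)"
    unfolding distH_def
  proof (rule cINF_greatest)
    fix p assume p: "p \<in> frontier wedge"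
    obtain x' y' t' where p': "p = (x',y',t')" by (metis prod_cases3)
    let ?d = "dH (x,0,0) (x',y',t')"
    have fr: "0 \<le> x'" "x' = 0 \<or> x' = roof y' t'" "x' \<le> roof y' t'"
      using frontier_wedge_cases p unfolding p' by blast+
    have "(x - x')^2 \<le> ?d^2" "(0 - y')^2 \<le> ?d^2"
      using dH_ge_Pr1[of x x' 0 y' 0 t'] by (smt (verit) zero_le_power2)+
    then have d: "\<bar>x - x'\<bar> \<le> ?d" "\<bar>y'\<bar> \<le> ?d"
      using dH_nonneg by (metis abs_le_square_iff abs_of_nonneg, simp add: abs_le_square_iff[symmetric] dH_nonneg)
    have t: "\<bar>- t' - 2 * (x * y')\<bar> \<le> ?d^2"
      using dH_ge_vertical[of 0 t' x' 0 x y'] by simp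
    show "x \<le> dH (x,0,0) p"
    proof (rule ccontr)
      assume "\<not> ?thesis"
      then have less: "?d < x" by (simp add: p')
      then have "x' \<noteq> 0" using d x by auto
      then have eq: "x' + \<bar>y'\<bar> + \<bar>t'\<bar> = 1" using fr by (simp add: roof_def)
      \<comment> \<open>The quadratic terms are replaced by linear ones, so that the three
        coordinates sum to at most \<open>6 * x\<close>, which is below 1.\<close>
      have "?d^2 \<le> 1 * ?d"
        unfolding power2_eq_square using less x dH_nonneg by (intro mult_right_mono) auto
      moreover have "\<bar>x * y'\<bar> \<le> 1 * \<bar>y'\<bar>"
        unfolding abs_mult using x by (intro mult_right_mono) auto
      ultimately show False using eq d t less x by linarith
    qed
  qed (use origin_in_frontier in auto)
qed

lemma dH_wedge_le:
  assumes "p \<in> wedge" "q \<in> wedge"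
  shows "dH p q \<le> 4"
proof -
  obtain x y t x' y' t' where p: "p = (x,y,t)" and q: "q = (x',y',t')"
    by (metis prod_cases3)
  have b: "0 < x" "x < 1" "\<bar>y\<bar> < 1" "\<bar>t\<bar> < 1" "0 < x'" "x' < 1" "\<bar>y'\<bar> < 1" "\<bar>t'\<bar> < 1"
    using assms wedge_subset_cube unfolding p q by blast+
  have "(x - x')^2 \<le> 2^2" "(y - y')^2 \<le> 2^2"
    using b by (intro iffD1[OF abs_le_square_iff]; simp; linarith)+
  then have "((x - x')^2 + (y - y')^2)^2 \<le> 8^2"
    by (intro power_mono) auto
  moreover have "\<bar>x' * y\<bar> \<le> 1 * 1" "\<bar>x * y'\<bar> \<le> 1 * 1"
    unfolding abs_mult using b by (intro mult_mono; simp)+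
  then have "\<bar>t - t' + 2 * (x' * y - x * y')\<bar> \<le> 8"
    using b(4,8) by (smt (verit))
  then have "(t - t' + 2 * (x' * y - x * y'))^2 \<le> 8^2"
    using abs_le_square_iff[of _ "8::real"] by simp
  \<comment> \<open>Numerically, \<open>8^2 + 8^2 = 128\<close> is at most
    \<open>4^4 = 256\<close>.\<close>
  ultimately have "dH p q ^ 4 \<le> 4 ^ 4"
    unfolding p q dH_pow4 by simp
  then show ?thesis by (subst (asm) power_mono_iff) (auto simp: dH_nonneg)
qed

lemma diamHS_wedge_le: "diamHS wedge \<le> 4"
  unfolding diamHS_def diamH_def
  by (intro SUP_least) (auto intro!: dH_wedge_le)

section \<open>The weighted geometric mean and H-convexity of \<open>sag\<close>\<close>

text \<open>Young's inequality for the ratios \<open>x / X\<close> and \<open>z / Z\<close>. The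
  right-hand side is the tangent plane at \<open>(X, Z)\<close>, so the graph lies below its tangent
  planes.\<close>

lemma geometric_mean_tangent:
  fixes a x z X Z :: real
  assumes a: "0 < a" "a < 1" and "0 \<le> x" "0 \<le> z" "0 < X" "0 < Z"
  shows "x powr a * z powr (1 - a) \<le> X powr a * Z powr (1 - a) * (a * (x / X) + (1 - a) * (z / Z))"
proof (cases "x = 0 \<or> z = 0")
  case True
  then show ?thesis using assms by auto
next
  case False
  have "(x / X) powr a * (z / Z) powr (1 - a) \<le> a * (x / X) + (1 - a) * (z / Z)"
    using Youngs_inequality_0[of a "1 - a" "x / X" "z / Z"] assms False by auto
  then show ?thesis
    using assms False by (simp add: powr_divide field_simps)
qed

text \<open>Average the tangent inequalities at the convex combination \<open>(X, Z)\<close>: there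
  the averaged bracket equals \<open>a + (1 - a) = 1\<close>.\<close>

lemma geometric_mean_concave:
  fixes a x1 z1 x2 z2 l :: real
  assumes a: "0 < a" "a < 1" and nn: "0 \<le> x1" "0 \<le> z1" "0 \<le> x2" "0 \<le> z2" and l: "0 \<le> l" "l \<le> 1"
  shows "(1 - l) * (x1 powr a * z1 powr (1 - a)) + l * (x2 powr a * z2 powr (1 - a))
    \<le> ((1 - l) * x1 + l * x2) powr a * ((1 - l) * z1 + l * z2) powr (1 - a)"
proof -
  define X Z where "X = (1 - l) * x1 + l * x2" and "Z = (1 - l) * z1 + l * z2"
  have XZ: "0 \<le> X" "0 \<le> Z" unfolding X_def Z_def using nn l by auto
  show ?thesis
  proof (cases "X = 0 \<or> Z = 0")
    case True
    \<comment> \<open>A vanishing sum of nonnegative terms has vanishing terms, so each product on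
      the left has a zero weight or a zero base.\<close>
    then have "((1 - l) * x1 = 0 \<and> l * x2 = 0) \<or> ((1 - l) * z1 = 0 \<and> l * z2 = 0)"
      unfolding X_def Z_def using nn l by (metis add_nonneg_eq_0_iff diff_ge_0_iff_ge mult_nonneg_nonneg)
    then have "(1 - l) * (x1 powr a * z1 powr (1 - a)) + l * (x2 powr a * z2 powr (1 - a)) = 0"
      by auto
    then show ?thesis by (simp only:) simp
  next
    case False
    then have pos: "0 < X" "0 < Z" using XZ by auto
    let ?G = "X powr a * Z powr (1 - a)"
    have "(1 - l) * (x1 powr a * z1 powr (1 - a)) + l * (x2 powr a * z2 powr (1 - a))
      \<le> (1 - l) * (?G * (a * (x1 / X) + (1 - a) * (z1 / Z)))
        + l * (?G * (a * (x2 / X) + (1 - a) * (z2 / Z)))"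
      using geometric_mean_tangent[OF a] nn pos l by (intro add_mono mult_left_mono) auto
    also have "\<dots> = ?G * (a * (((1 - l) * x1 + l * x2) / X) + (1 - a) * (((1 - l) * z1 + l * z2) / Z))"
      by (simp add: algebra_simps add_divide_distrib diff_divide_distrib)
    also have "\<dots> = ?G"
      using pos unfolding X_def[symmetric] Z_def[symmetric] by simp
    finally show ?thesis unfolding X_def Z_def .
  qed
qed

text \<open>The increment \<open>hinv \<xi>1 \<circ>\<^sub>H \<xi>2\<close> between points in
  horizontal position has third coordinate 0, so the factor \<open>l^2\<close> of the dilation acts
  on nothing and the curve is the Euclidean segment. Euclidean convexity therefore implies
  H-convexity.\<close>

lemma horizontal_segment:
  assumes "(x1,y1,t1) \<in> hplane (x2,y2,t2)"
  shows "(x1,y1,t1) \<circ>\<^sub>H hdil l (hinv (x1,y1,t1) \<circ>\<^sub>H (x2,y2,t2)) =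
    ((1 - l) * x1 + l * x2, (1 - l) * y1 + l * y2, (1 - l) * t1 + l * t2)"
proof -
  have t1: "t1 = t2 + 2 * (x1 * y2 - x2 * y1)" using assms by (simp add: hplane_def)
  show ?thesis by (simp add: t1 hmult_def hdil_def hinv_def algebra_simps)
qed

text \<open>The geometric mean is concave and nondecreasing in its second argument, and
  \<open>roof\<close> is concave, so their composition is concave; \<open>sag a\<close> is a linear
  function minus it.\<close>

lemma sag_H_convex:
  assumes a: "0 < a" "a < 1"
  shows "H_convex_on (closure wedge) (sag a)"
  unfolding H_convex_on_def
proof (intro ballI impI)
  fix p q :: heis and l :: real
  assume pq: "p \<in> closure wedge" "q \<in> closure wedge" "p \<in> hplane q" and "l \<in> {0..1}"
  then have l: "0 \<le> l" "l \<le> 1" by auto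
  obtain x1 y1 t1 x2 y2 t2 where p: "p = (x1,y1,t1)" and q: "q = (x2,y2,t2)"
    by (metis prod_cases3)
  have x: "0 \<le> x1" "x1 \<le> roof y1 t1" "0 \<le> x2" "x2 \<le> roof y2 t2"
    using pq closure_wedge_subset unfolding p q by auto
  let ?X = "(1 - l) * x1 + l * x2" and ?Z = "(1 - l) * roof y1 t1 + l * roof y2 t2"
  let ?R = "roof ((1 - l) * y1 + l * y2) ((1 - l) * t1 + l * t2)"
  have "0 \<le> ?Z" using x l by (intro add_nonneg_nonneg mult_nonneg_nonneg) auto
  then have "?Z powr (1 - a) \<le> ?R powr (1 - a)"
    using a roof_concave[OF l] by (intro powr_mono2) auto
  then have "?X powr a * ?Z powr (1 - a) \<le> ?X powr a * ?R powr (1 - a)"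
    by (intro mult_left_mono) auto
  moreover have "(1 - l) * (x1 powr a * roof y1 t1 powr (1 - a)) + l * (x2 powr a * roof y2 t2 powr (1 - a))
      \<le> ?X powr a * ?Z powr (1 - a)"
    using geometric_mean_concave[OF a] x l by auto
  ultimately show "sag a (p \<circ>\<^sub>H hdil l (hinv p \<circ>\<^sub>H q)) \<le> (1 - l) * sag a p + l * sag a q"
    using horizontal_segment pq(3) unfolding p q by (simp add: sag_def algebra_simps)
qed

lemma sag_continuous:
  assumes "0 < a" "a < 1"
  shows "continuous_on (closure wedge) (sag a)"
proof -
  have "0 \<le> fst p \<and> 0 \<le> roof (fst (snd p)) (snd (snd p))" if "p \<in> closure wedge" for p
    using that closure_wedge_subset by force
  then show ?thesis
    unfolding sag_def case_prod_unfold roof_def using assms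
    by (intro continuous_on_diff continuous_on_mult continuous_on_powr' continuous_intros) auto
qed

lemma sag_frontier:
  assumes "0 < a" "a < 1" "p \<in> frontier wedge"
  shows "sag a p = 0"
proof -
  obtain x y t where p: "p = (x,y,t)" by (metis prod_cases3)
  have "x powr a * x powr (1 - a) = x" if "0 \<le> x"
    using that by (simp flip: powr_add)
  then show ?thesis
    using frontier_wedge_cases[of x y t] assms by (auto simp: p sag_def)
qed

lemma sag_neg:
  assumes "0 < a" "a < 1" "p \<in> wedge"
  shows "sag a p < 0"
proof -
  obtain x y t where p: "p = (x,y,t)" by (metis prod_cases3)
  have x: "0 < x" "x < roof y t" using assms by (auto simp: p mem_wedge)
  have "x = x powr a * x powr (1 - a)"
    using x by (simp flip: powr_add)
  also have "\<dots> < x powr a * roof y t powr (1 - a)"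
    using x assms by (intro mult_strict_left_mono powr_less_mono2) auto
  finally show ?thesis by (simp add: p sag_def)
qed

section \<open>Bounds on the horizontal subgradients\<close>

text \<open>Since \<open>b - 1 \<le> 0\<close>, replacing \<open>z powr (b - 1)\<close> by
  \<open>c powr (b - 1)\<close> in \<open>z powr b = z * z powr (b - 1)\<close> only increases
  it.\<close>

lemma powr_diff_le:
  fixes b c z :: real
  assumes "0 < c" "c \<le> z" "b \<le> 1"
  shows "z powr b - c powr b \<le> c powr (b - 1) * (z - c)"
proof -
  have "z powr (b - 1) \<le> c powr (b - 1)"
    using assms by (intro powr_mono2') auto
  then have "z * z powr (b - 1) \<le> z * c powr (b - 1)"
    using assms by (intro mult_left_mono) auto
  then show ?thesis
    using assms by (simp add: powr_diff field_simps)
qed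

text \<open>A one-sided Lipschitz estimate. The factor-two conditions keep the powers at the new
  point comparable to those at the old one; growth of \<open>x\<close> or of the roof only lowers
  the subtracted difference, so no upper bound on \<open>x'\<close> enters.\<close>

lemma sag_increment:
  assumes a: "0 < a" "a < 1" and w: "(x,y,t) \<in> wedge"
    and x': "x / 2 \<le> x'" and z': "roof y t / 2 \<le> roof y' t'" "roof y' t' \<le> 2 * roof y t"
  shows "sag a (x',y',t') - sag a (x,y,t) \<le>
    (x' - x) + 4 * (x / roof y t) powr (a - 1) * \<bar>x' - x\<bar>
             + 2 * (x / roof y t) powr a * \<bar>roof y' t' - roof y t\<bar>"
proof -
  define z z' where "z = roof y t" and "z' = roof y' t'"
  have x: "0 < x" "x < z" using w by (auto simp: mem_wedge z_def)
  have 2: "2 powr b \<le> (2::real)" if "b \<le> 1" for b using powr_mono[OF that, of 2] by simp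
  have half: "(c / 2) powr (- b) \<le> 2 * c powr (- b)" if "0 \<le> b" "b \<le> 1" "0 < c" for b c :: real
    using 2[of b] that by (simp add: powr_divide powr_minus field_simps)
  have A: "x powr a - x' powr a \<le> 2 * x powr (a - 1) * \<bar>x' - x\<bar>"
  proof (cases "x' \<le> x")
    case True
    have "x powr a - x' powr a \<le> x' powr (a - 1) * (x - x')"
      using True x x' a by (intro powr_diff_le) auto
    also have "x' powr (a - 1) \<le> (x / 2) powr (- (1 - a))"
      using x x' a by (simp add: powr_mono2')
    also have "\<dots> \<le> 2 * x powr (a - 1)"
      using half[of "1 - a" x] a x by simp
    finally show ?thesis using True by (simp add: mult_right_mono)
  next
    case False
    then have "x powr a \<le> x' powr a" using x a by (intro powr_mono2) auto
    then show ?thesis by (smt (verit) mult_nonneg_nonneg powr_ge_zero)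
  qed
  have B: "z powr (1 - a) - z' powr (1 - a) \<le> 2 * z powr (- a) * \<bar>z' - z\<bar>"
  proof (cases "z' \<le> z")
    case True
    have "z powr (1 - a) - z' powr (1 - a) \<le> z' powr (1 - a - 1) * (z - z')"
      using True x z' a by (intro powr_diff_le) (auto simp: z_def z'_def)
    also have "z' powr (1 - a - 1) \<le> (z / 2) powr (- a)"
      using x z' a by (simp add: powr_mono2' z_def z'_def)
    also have "\<dots> \<le> 2 * z powr (- a)"
      using half[of a z] a x by simp
    finally show ?thesis using True by (simp add: mult_right_mono)
  next
    case False
    then have "z powr (1 - a) \<le> z' powr (1 - a)" using x a by (intro powr_mono2) auto
    then show ?thesis by (smt (verit) mult_nonneg_nonneg powr_ge_zero)
  qed
  have C: "z' powr (1 - a) \<le> 2 * z powr (1 - a)"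
  proof -
    have "z' powr (1 - a) \<le> (2 * z) powr (1 - a)"
      using x z' a by (intro powr_mono2) (auto simp: z_def z'_def)
    also have "\<dots> \<le> 2 * z powr (1 - a)"
      using x a 2[of "1 - a"] by (simp add: powr_mult mult_right_mono)
    finally show ?thesis .
  qed
  \<comment> \<open>One factor changes at a time. The second term carries the moved
    \<open>z'\<close>, which \<open>C\<close> returns to \<open>z\<close>; together with
    \<open>A\<close> this gives the constant \<open>2 * 2 = 4\<close>.\<close>
  have "x powr a * z powr (1 - a) - x' powr a * z' powr (1 - a)
      = x powr a * (z powr (1 - a) - z' powr (1 - a)) + z' powr (1 - a) * (x powr a - x' powr a)"
    by (simp add: algebra_simps)
  also have "\<dots> \<le> x powr a * (2 * z powr (- a) * \<bar>z' - z\<bar>)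
      + z' powr (1 - a) * (2 * x powr (a - 1) * \<bar>x' - x\<bar>)"
    using A B by (intro add_mono mult_left_mono) auto
  also have "\<dots> \<le> x powr a * (2 * z powr (- a) * \<bar>z' - z\<bar>)
      + (2 * z powr (1 - a)) * (2 * x powr (a - 1) * \<bar>x' - x\<bar>)"
    using C by (intro add_mono mult_right_mono) auto
  also have "\<dots> = 2 * (x / z) powr a * \<bar>z' - z\<bar> + 4 * (x / z) powr (a - 1) * \<bar>x' - x\<bar>"
    using x by (simp add: powr_divide powr_minus powr_diff field_simps)
  finally show ?thesis
    by (simp add: sag_def z_def z'_def)
qed

text \<open>With \<open>\<rho> = x / roof y t\<close>, compare \<open>sag\<close> with its values at points reached
  by short horizontal steps in the directions \<open>X\<close> and \<open>Y\<close>.\<close>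

lemma subdiffH_sag_bound:
  assumes a: "0 < a" "a < 1" and w: "(x,y,t) \<in> wedge"
    and p: "(p1,p2) \<in> subdiffH wedge (sag a) (x,y,t)"
  shows "\<bar>p1\<bar> \<le> 11 * (x / roof y t) powr (a - 1)" "\<bar>p2\<bar> \<le> 6 * (x / roof y t) powr a"
proof -
  define z where "z = roof y t"
  define \<rho> where "\<rho> = x / z"
  have x: "0 < x" "x < z" using w by (auto simp: mem_wedge z_def)
  have cube: "x < 1" "\<bar>y\<bar> < 1" using w wedge_subset_cube by blast+
  have step: "p1 * h + p2 * k \<le> h + 4 * \<rho> powr (a - 1) * \<bar>h\<bar> + 6 * \<rho> powr a * (\<bar>h\<bar> + \<bar>k\<bar>)"
    \<comment> \<open>The roof height moves by at most
      \<open>3 * (\<bar>h\<bar> + \<bar>k\<bar>)\<close>, so these bounds keep the new point in the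
      wedge and its coordinates in the range of \<open>sag_increment\<close>.\<close>
    if small: "\<bar>h\<bar> \<le> x / 2" "\<bar>h\<bar> + \<bar>k\<bar> \<le> (z - x) / 8" for h k
  proof -
    \<comment> \<open>The unique height over \<open>(x + h, y + k)\<close> on the horizontal plane
      at \<open>(x, y, t)\<close>.\<close>
    define t' where "t' = t + 2 * ((x + h) * y - x * (y + k))"
    define z' where "z' = roof (y + k) t'"
    have "\<bar>h * y\<bar> \<le> \<bar>h\<bar> * 1" "\<bar>x * k\<bar> \<le> 1 * \<bar>k\<bar>"
      unfolding abs_mult using cube x by (intro mult_mono; simp)+
    moreover have "t' - t = 2 * (h * y) - 2 * (x * k)"
      by (simp add: t'_def algebra_simps)
    ultimately have "\<bar>t' - t\<bar> \<le> 2 * \<bar>h\<bar> + 2 * \<bar>k\<bar>" by linarith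
    moreover have "\<bar>z' - z\<bar> \<le> \<bar>k\<bar> + \<bar>t' - t\<bar>"
      using roof_lipschitz[of "y + k" t' y t] by (simp add: z'_def z_def)
    ultimately have lip: "\<bar>z' - z\<bar> \<le> 3 * (\<bar>h\<bar> + \<bar>k\<bar>)" by (smt (verit))
    have "x + h \<le> x + \<bar>h\<bar>" by simp
    also have "\<dots> < z - 3 * (\<bar>h\<bar> + \<bar>k\<bar>)" using small(2) x(2) by simp
    also have "\<dots> \<le> z'" using lip by linarith
    finally have "x + h < z'" .
    moreover have "0 < x + h" using small(1) x(1) by linarith
    ultimately have "(x + h, y + k, t') \<in> wedge"
      by (simp add: mem_wedge z'_def)
    moreover have "(x + h, y + k, t') \<in> hplane (x,y,t)"
      by (simp add: hplane_def t'_def)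
    ultimately have "sag a (x,y,t) + inner (p1,p2) (Pr1 (x + h, y + k, t') - Pr1 (x,y,t))
        \<le> sag a (x + h, y + k, t')"
      using p unfolding subdiffH_def by blast
    then have "p1 * h + p2 * k \<le> sag a (x + h, y + k, t') - sag a (x,y,t)"
      by (simp add: Pr1_def)
    also have "\<dots> \<le> h + 4 * \<rho> powr (a - 1) * \<bar>h\<bar> + 2 * \<rho> powr a * \<bar>z' - z\<bar>"
      using sag_increment[OF a w, of "x + h" "y + k" t'] lip small x
      unfolding \<rho>_def z_def[symmetric] z'_def[symmetric] by simp
    also have "2 * \<rho> powr a * \<bar>z' - z\<bar> \<le> 2 * \<rho> powr a * (3 * (\<bar>h\<bar> + \<bar>k\<bar>))"
      using lip by (intro mult_left_mono) auto
    finally show ?thesis by (simp add: algebra_simps)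
  qed
  define d where "d = min (x / 2) ((z - x) / 8)"
  have d: "0 < d" "d \<le> x / 2" "d \<le> (z - x) / 8" using x by (auto simp: d_def min_def)
  have \<rho>: "0 < \<rho>" "\<rho> < 1" using x by (auto simp: \<rho>_def)
  \<comment> \<open>As \<open>\<rho> powr a \<le> 1 \<le> \<rho> powr (a - 1)\<close>, all three
    terms are absorbed in the largest power: \<open>1 + 4 + 6 = 11\<close>.\<close>
  have "\<rho> powr a \<le> 1" using \<rho> a by (intro powr_le1) auto
  moreover have "1 \<le> \<rho> powr (a - 1)" using \<rho> a powr_mono2'[of "a - 1" \<rho> 1] by simp
  moreover have "p1 * d \<le> (1 + 4 * \<rho> powr (a - 1) + 6 * \<rho> powr a) * d"
    "- p1 * d \<le> (1 + 4 * \<rho> powr (a - 1) + 6 * \<rho> powr a) * d"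
    using step[of d 0] step[of "- d" 0] d by (auto simp: algebra_simps)
  then have "p1 \<le> 1 + 4 * \<rho> powr (a - 1) + 6 * \<rho> powr a"
    "- p1 \<le> 1 + 4 * \<rho> powr (a - 1) + 6 * \<rho> powr a"
    using d(1) by (simp_all only: mult_le_cancel_right_pos)
  ultimately show "\<bar>p1\<bar> \<le> 11 * (x / roof y t) powr (a - 1)"
    unfolding \<rho>_def z_def by linarith
  have "p2 * d \<le> (6 * \<rho> powr a) * d" "- p2 * d \<le> (6 * \<rho> powr a) * d"
    using step[of 0 d] step[of 0 "- d"] d by (auto simp: algebra_simps)
  then have "p2 \<le> 6 * \<rho> powr a" "- p2 \<le> 6 * \<rho> powr a"
    using d(1) by (simp_all only: mult_le_cancel_right_pos)
  then show "\<bar>p2\<bar> \<le> 6 * (x / roof y t) powr a"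
    unfolding \<rho>_def z_def by linarith
qed

section \<open>Finite area of the subgradient image\<close>

lemma emeasure_centered_rectangle:
  fixes A B :: real
  assumes "0 \<le> A" "0 \<le> B"
  shows "emeasure lebesgue (cbox (- A, - B) (A, B)) = ennreal (4 * A * B)"
proof -
  have "measure lborel (cbox (- A, - B) (A, B)) = 4 * A * B"
    using assms by (simp add: content_Pair)
  moreover have "emeasure lborel (cbox (- A, - B) (A, B)) \<noteq> \<infinity>"
    using emeasure_lborel_cbox_finite[of "(-A,-B)" "(A,B)"] by auto
  ultimately show ?thesis
    by (simp add: emeasure_eq_ennreal_measure)
qed

text \<open>The scale \<open>2 powr -(n+1) < \<rho> \<le> 2 powr -n\<close> contributes gradients in a rectangle of
  area comparable to \<open>2 powr (n * (1 - 2 * a))\<close>, which is where \<open>a > 1/2\<close> is needed.\<close>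

lemma L2_HS_sag_finite:
  assumes a: "1/2 < a" "a < 1"
  shows "L2_HS wedge (sag a) < \<infinity>"
proof -
  \<comment> \<open>The factors 11 and 6 come from \<open>subdiffH_sag_bound\<close>. Each side
    takes the worst end of its scale: \<open>\<rho> powr (a - 1)\<close> at the lower end,
    \<open>\<rho> powr a\<close> at the upper.\<close>
  define R :: "nat \<Rightarrow> (real \<times> real) set" where
    "R n = cbox (- (11 * 2 powr ((n + 1) * (1 - a))), - (6 * 2 powr (- n * a)))
                (11 * 2 powr ((n + 1) * (1 - a)), 6 * 2 powr (- n * a))" for n
  have cover: "subdiffH wedge (sag a) \<xi> \<subseteq> (\<Union>n. R n)" if "\<xi> \<in> wedge" for \<xi>
  proof
    fix p assume p: "p \<in> subdiffH wedge (sag a) \<xi>"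
    obtain x y t where \<xi>: "\<xi> = (x,y,t)" by (metis prod_cases3)
    obtain p1 p2 where p12: "p = (p1,p2)" by fastforce
    define \<rho> where "\<rho> = x / roof y t"
    have \<rho>: "0 < \<rho>" "\<rho> < 1" using that by (auto simp: \<xi> mem_wedge \<rho>_def)
    define n where "n = nat \<lfloor>- log 2 \<rho>\<rfloor>"
    have "0 \<le> - log 2 \<rho>" using \<rho> by simp
    then have n: "real n \<le> - log 2 \<rho>" "- log 2 \<rho> \<le> real n + 1"
      unfolding n_def by linarith+
    have \<rho>_eq: "\<rho> powr b = 2 powr (log 2 \<rho> * b)" for b
      using \<rho> by (simp flip: powr_powr)
    have "\<bar>p1\<bar> \<le> 11 * \<rho> powr (a - 1)" "\<bar>p2\<bar> \<le> 6 * \<rho> powr a"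
      using subdiffH_sag_bound[of a x y t p1 p2] a that p unfolding \<xi> p12 \<rho>_def by auto
    moreover have "log 2 \<rho> * (a - 1) \<le> (n + 1) * (1 - a)"
      using mult_right_mono[OF n(2), of "1 - a"] a by (simp add: algebra_simps)
    then have "\<rho> powr (a - 1) \<le> 2 powr ((n + 1) * (1 - a))"
      unfolding \<rho>_eq by (intro powr_mono) auto
    moreover have "log 2 \<rho> * a \<le> - n * a"
      using n(1) a by (intro mult_right_mono) auto
    then have "\<rho> powr a \<le> 2 powr (- n * a)"
      unfolding \<rho>_eq by (intro powr_mono) auto
    ultimately have "p \<in> R n"
      by (simp add: R_def p12 cbox_Pair_eq abs_le_iff add.commute)
    then show "p \<in> (\<Union>n. R n)" by blast
  qed
  \<comment> \<open>The ratio of the areas of consecutive rectangles, so the total area is bounded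
    by a geometric series; \<open>264 = 4 * 11 * 6\<close> below.\<close>
  define q where "q = (2::real) powr (1 - 2 * a)"
  have "q < 2 powr 0" unfolding q_def using a by (intro powr_less_mono) auto
  then have q: "0 \<le> q" "q < 1" by (auto simp: q_def)
  have area: "emeasure lebesgue (R n) = ennreal (264 * 2 powr (1 - a) * q ^ n)" for n
  proof -
    have "2 powr ((n + 1) * (1 - a)) * 2 powr (- n * a) = 2 powr (1 - a) * q ^ n"
      by (simp add: q_def powr_realpow[symmetric] powr_powr algebra_simps flip: powr_add)
    then show ?thesis
      unfolding R_def by (subst emeasure_centered_rectangle) (auto simp: ac_simps)
  qed
  have R: "range R \<subseteq> sets lebesgue" by (auto simp: R_def)
  have "emeasure lebesgue (\<Union>n. R n) \<le> (\<Sum>n. emeasure lebesgue (R n))"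
    by (rule emeasure_subadditive_countably[OF R])
  also have "\<dots> = ennreal (\<Sum>n. 264 * 2 powr (1 - a) * q ^ n)"
    unfolding area using q by (intro suminf_ennreal2 summable_mult summable_geometric) auto
  finally have fin: "emeasure lebesgue (\<Union>n. R n) < \<infinity>"
    by (simp add: le_less_trans)
  have "(\<Union>n. R n) \<in> sets lebesgue" using R by blast
  \<comment> \<open>The cover is the same for every base point, so it is a competitor in the infimum
    defining \<open>L2\<close> for every plane at once.\<close>
  then have "L2 (subdiffH_set wedge (sag a) (wedge \<inter> hplane \<xi>)) \<le> emeasure lebesgue (\<Union>n. R n)" for \<xi>
    unfolding L2_def subdiffH_set_def using cover by (intro INF_lower) blast
  then have "L2_HS wedge (sag a) \<le> emeasure lebesgue (\<Union>n. R n)"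
    unfolding L2_HS_def by (intro SUP_least)
  then show ?thesis using fin by (rule le_less_trans)
qed

section \<open>Growth of \<open>sag\<close> along the axis\<close>

text \<open>On the axis \<open>sag a\<close> equals \<open>x - x powr a\<close>, whose modulus
  exceeds \<open>x powr a / 2\<close> for small \<open>x\<close>, while \<open>B * x powr s\<close>
  is of smaller order than \<open>x powr (2 * a)\<close>.\<close>

lemma sag_axis_unbounded:
  fixes a s B :: real
  assumes a: "0 < a" "a < 1" and s: "2 * a < s"
  obtains x where "0 < x" "x \<le> 1/20" "(x,0,0) \<in> wedge" "B * x powr s < \<bar>sag a (x,0,0)\<bar>^2"
proof -
  have 0: "((\<lambda>x::real. x powr b) \<longlongrightarrow> 0) (at_right 0)" if "0 < b" for b
    using that by (auto intro!: tendsto_eq_intros tendsto_powr' simp: eventually_at_filter)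
  have 1: "((\<lambda>x::real. B * x powr (s - 2 * a)) \<longlongrightarrow> 0) (at_right 0)"
    using tendsto_mult_left[OF 0[of "s - 2 * a"], of B] s by simp
  \<comment> \<open>The threshold 1/2 gives \<open>x < x powr a / 2\<close>, 1/4 is its square on
    the other side of the comparison, and 1/20 is the range of \<open>distH_axis\<close>.\<close>
  have "\<forall>\<^sub>F x in at_right 0. x powr (1 - a) < 1/2 \<and> B * x powr (s - 2 * a) < 1/4 \<and> 0 < x \<and> x < (1/20::real)"
    using order_tendstoD(2)[OF 0[of "1 - a"], of "1/2"] order_tendstoD(2)[OF 1, of "1/4"] a
      eventually_at_right_less[of "0::real"] eventually_at_right_real[of "0::real" "1/20"]
    by (auto elim!: eventually_elim2 simp: eventually_conj_iff)
  then obtain x where x: "x powr (1 - a) < 1/2" "B * x powr (s - 2 * a) < 1/4" "0 < x" "x < 1/20"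
    using eventually_happens by fastforce
  have "x = x powr a * x powr (1 - a)" using x(3) by (simp flip: powr_add)
  also have "\<dots> < x powr a * (1/2)" using x by (intro mult_strict_left_mono) auto
  finally have "x < x powr a / 2" by simp
  moreover have "sag a (x,0,0) = x - x powr a" by (simp add: sag_def roof_def)
  ultimately have "x powr a / 2 < \<bar>sag a (x,0,0)\<bar>" by linarith
  then have lower: "(x powr a / 2)^2 < \<bar>sag a (x,0,0)\<bar>^2" by (intro power_strict_mono) auto
  have "B * x powr s = B * x powr (s - 2 * a) * (x powr a)^2"
    by (simp add: power2_eq_square mult.assoc flip: powr_add)
  also have "\<dots> \<le> 1/4 * (x powr a)^2"
    using x(2) by (intro mult_right_mono) auto
  finally have "B * x powr s < \<bar>sag a (x,0,0)\<bar>^2"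
    using lower by (simp add: power_divide)
  then show thesis using that x by (simp add: mem_wedge roof_def)
qed

section \<open>Failure of every exponent above 1\<close>

theorem theorem5p2:
  shows "(\<forall>s::real. s > 1 \<longrightarrow>
           \<not> (\<exists>C1::real. C1 > 0 \<and>
                (\<forall>(\<Omega>::heis set) (u::heis \<Rightarrow> real).
                   open \<Omega> \<and> horiz_bounded \<Omega> \<and> convex \<Omega> \<and>
                   continuous_on (closure \<Omega>) u \<and> H_convex_on (closure \<Omega>) u \<and>
                   (\<forall>\<xi>\<in>frontier \<Omega>. u \<xi> = 0) \<longrightarrow>
                   (\<forall>\<xi>\<in>\<Omega>. ereal (\<bar>u \<xi>\<bar>^2) \<le>
                        ereal (C1 * distH \<xi> (frontier \<Omega>) powr s) * diamHS \<Omega>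
                          * enn2ereal (L2_HS \<Omega> u)))))
       \<and> (\<forall>\<epsilon>::real. 0 < \<epsilon> \<and> \<epsilon> < 1 \<longrightarrow>
           (\<exists>(\<Omega>::heis set) (u::heis \<Rightarrow> real).
              open \<Omega> \<and> bounded \<Omega> \<and> convex \<Omega> \<and>
              continuous_on (closure \<Omega>) u \<and> H_convex_on (closure \<Omega>) u \<and>
              (\<forall>\<xi>\<in>frontier \<Omega>. u \<xi> = 0) \<and> (\<forall>\<xi>\<in>\<Omega>. u \<xi> < 0) \<and>
              L2_HS \<Omega> u < \<infinity> \<and>
              (SUP \<xi>\<in>\<Omega>. ereal (\<bar>u \<xi>\<bar>^2 / distH \<xi> (frontier \<Omega>) powr (1 + \<epsilon>))) = \<infinity>))"
proof (intro conjI allI impI notI)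
  fix s :: real assume "1 < s"
  \<comment> \<open>For \<open>s > 1\<close>, \<open>(1 + s) / 4\<close> exceeds 1/2 and its double
    is below \<open>s\<close>; the cap 3/4 keeps \<open>a < 1\<close>.\<close>
  define a where "a = min (3/4) ((1 + s) / 4)"
  have a: "1/2 < a" "a < 1" "2 * a < s" using \<open>1 < s\<close> by (auto simp: a_def min_def)
  assume "\<exists>C1::real. C1 > 0 \<and>
                (\<forall>(\<Omega>::heis set) (u::heis \<Rightarrow> real).
                   open \<Omega> \<and> horiz_bounded \<Omega> \<and> convex \<Omega> \<and>
                   continuous_on (closure \<Omega>) u \<and> H_convex_on (closure \<Omega>) u \<and>
                   (\<forall>\<xi>\<in>frontier \<Omega>. u \<xi> = 0) \<longrightarrow>
                   (\<forall>\<xi>\<in>\<Omega>. ereal (\<bar>u \<xi>\<bar>^2) \<le>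
                        ereal (C1 * distH \<xi> (frontier \<Omega>) powr s) * diamHS \<Omega>
                          * enn2ereal (L2_HS \<Omega> u)))"
  moreover have "horiz_bounded wedge"
    unfolding horiz_bounded_def using diamHS_wedge_le by (rule le_less_trans) simp
  ultimately obtain C where C: "0 < C"
    and est: "\<And>\<xi>. \<xi> \<in> wedge \<Longrightarrow> ereal (\<bar>sag a \<xi>\<bar>^2) \<le>
      ereal (C * distH \<xi> (frontier wedge) powr s) * diamHS wedge * enn2ereal (L2_HS wedge (sag a))"
    using a open_wedge convex_wedge sag_continuous[of a] sag_H_convex[of a] sag_frontier[of a]
    by (auto 0 3)
  obtain L where L: "0 \<le> L" "L2_HS wedge (sag a) = ennreal L"
    using L2_HS_sag_finite[OF a(1,2)] by (auto simp: less_top_ennreal)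
  \<comment> \<open>The factor 4 is the bound on \<open>diamHS wedge\<close>, so the chosen point
    beats the whole right-hand side of the supposed estimate.\<close>
  obtain x where x: "0 < x" "x \<le> 1/20" "(x,0,0) \<in> wedge"
    and big: "C * 4 * L * x powr s < \<bar>sag a (x,0,0)\<bar>^2"
    using sag_axis_unbounded[of a s "C * 4 * L"] a by auto
  have "ereal (\<bar>sag a (x,0,0)\<bar>^2) \<le> ereal (C * x powr s) * diamHS wedge * ereal L"
    using est[OF x(3)] distH_axis[OF x(1,2)] L by simp
  also have "\<dots> \<le> ereal (C * x powr s) * 4 * ereal L"
    using C L diamHS_wedge_le by (intro ereal_mult_right_mono ereal_mult_left_mono) auto
  also have "\<dots> = ereal (C * 4 * L * x powr s)"
    by (simp add: mult_ac)
  finally show False using big by simp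
next
  fix \<epsilon> :: real assume \<epsilon>: "0 < \<epsilon> \<and> \<epsilon> < 1"
  \<comment> \<open>Then \<open>2 * a = 1 + \<epsilon>/2\<close> lies halfway between 1 and the
    exponent \<open>1 + \<epsilon>\<close>.\<close>
  define a where "a = 1/2 + \<epsilon>/4"
  have a: "1/2 < a" "0 < a" "a < 1" "2 * a < 1 + \<epsilon>" using \<epsilon> by (auto simp: a_def)
  have "(SUP \<xi>\<in>wedge. ereal (\<bar>sag a \<xi>\<bar>^2 / distH \<xi> (frontier wedge) powr (1 + \<epsilon>))) = \<infinity>"
  proof (rule SUP_PInfty)
    fix n :: nat
    obtain x where x: "0 < x" "x \<le> 1/20" "(x,0,0) \<in> wedge"
      and "real n * x powr (1 + \<epsilon>) < \<bar>sag a (x,0,0)\<bar>^2"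
      using sag_axis_unbounded[OF a(2-4)] by blast
    then have "real n \<le> \<bar>sag a (x,0,0)\<bar>^2 / distH (x,0,0) (frontier wedge) powr (1 + \<epsilon>)"
      by (simp add: distH_axis pos_le_divide_eq)
    then show "\<exists>\<xi>\<in>wedge. ereal (real n) \<le> ereal (\<bar>sag a \<xi>\<bar>^2 / distH \<xi> (frontier wedge) powr (1 + \<epsilon>))"
      using x(3) by (intro bexI[of _ "(x,0,0)"]) auto
  qed
  then show "\<exists>(\<Omega>::heis set) (u::heis \<Rightarrow> real).
              open \<Omega> \<and> bounded \<Omega> \<and> convex \<Omega> \<and>
              continuous_on (closure \<Omega>) u \<and> H_convex_on (closure \<Omega>) u \<and>
              (\<forall>\<xi>\<in>frontier \<Omega>. u \<xi> = 0) \<and> (\<forall>\<xi>\<in>\<Omega>. u \<xi> < 0) \<and>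
              L2_HS \<Omega> u < \<infinity> \<and>
              (SUP \<xi>\<in>\<Omega>. ereal (\<bar>u \<xi>\<bar>^2 / distH \<xi> (frontier \<Omega>) powr (1 + \<epsilon>))) = \<infinity>"
    using a open_wedge bounded_wedge convex_wedge sag_continuous[of a] sag_H_convex[of a]
      sag_frontier[of a] sag_neg[of a] L2_HS_sag_finite[of a]
    by (intro exI[of _ wedge] exI[of _ "sag a"]) auto
qed

end
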